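(* Assume that the events $E_1,E_2,E_3,H_1,H_2,H_3$ are logically independent and let $(x_1,x_2,x_3)\in[0,1]^3$. If the assessment $(x_1,x_2,x_3,T_L(x_1,x_2),T_L(x_1,x_3),T_L(x_2,x_3),T_L(x_1,x_2,x_3))$ on the family $\mathcal F=\{\mathcal C_1,\mathcal C_2,\mathcal C_3,\mathcal C_{12},\mathcal C_{13},\mathcal C_{23},\mathcal C_{123}\}$ is such that $T_L(x_1,x_2,x_3)>0$, then the assessment is coherent.
   Context: **Lukasiewicz t-norm.** $T_L(u,v)=\max\{u+v-1,0\}$ for $u,v\in[0,1]$, and $T_L(x_1,x_2,x_3)=T_L(T_L(x_1,x_2),x_3)=\max\{x_1+x_2+x_3-2,0\}$. **Events.** Events are subsets of a set $\Omega$ of elementary outcomes; $\overline{E}$ is the complement of $E$, juxtaposition $EF$ denotes intersection, $\vee$ denotes union. Events $F_1,\dots,F_n$ are logically independent if all $2^n$ intersections $F_1^*\cdots F_n^*$, with $F_i^*\in\{F_i,\overline{F}_i\}$, are nonempty. **Conjunctions.** Given conditional events $E_1|H_1,E_2|H_2,E_3|H_3$ and a real number $x_S$ for each nonempty $S\subseteq\{1,2,3\}$ (written $x_i,x_{ij},x_{123}$, with $x_{ij}=x_{ji}$), where $x_S$ is the prevision assessed on $\bigwedge_{i\in S}(E_i|H_i)$, the conjunction $\mathcal C_S=\bigwedge_{i\in S}(E_i|H_i)$ (written $\mathcal C_i,\mathcal C_{ij},\mathcal C_{123}$) is the random quantity equal to: $1$ on $\bigwedge_{i\in S}E_iH_i$;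 $0$ on $\bigvee_{i\in S}\overline{E}_iH_i$; and $x_{S'}$ on $\bigwedge_{i\in S'}\overline{H}_i\wedge\bigwedge_{i\in S\setminus S'}E_iH_i$, for each $\emptyset\neq S'\subseteq S$. In particular $\mathcal C_i=E_i|H_i$ equals $1$ on $E_iH_i$, $0$ on $\overline{E}_iH_i$, $x_i$ on $\overline{H}_i$. $\mathcal C_S$ is a conditional random quantity with conditioning event $\bigvee_{i\in S}H_i$ and prevision $x_S$. **Coherence.** Let $\mathcal F=\{X_1|K_1,\dots,X_n|K_n\}$ be a finite family of conditional random quantities, where $X_i$ takes finitely many real values when the conditioning event $K_i\ne\emptyset$ is true, and let $\mathcal M=(\mu_1,\dots,\mu_n)\in\mathbb R^n$ be a (prevision) assessment, $\mu_i=\mathbb P(X_i|K_i)$. Let $C_1,\dots,C_m$ be the constituents contained in $K_1\vee\cdots\vee K_n$, i.e. the nonempty atoms of the finite partition generated by the events $K_i$ and the events $(X_i=\text{value})\cap K_i$. To $C_h$ associate $Q_h=(q_{h1},\dots,q_{hn})$, where $q_{hi}$ is the value of $X_i$ on $C_h$ if $C_h\subseteq K_i$, and $q_{hi}=\mu_i$ if $C_h\subseteq\overline{K}_i$. Let $S$ be the set of vectors $(\lambda_1,\dots,\lambda_m)$ with $\lambda_h\ge 0$, $\sum_h\lambda_h=1$, $\sum_h\lambda_hQ_h=\mathcal M$, and, when $S\neq\emptyset$, let $I_0=\{i:\max_{\Lambda\in S}\sum_{h:C_h\subseteq K_i}\lambda_h=0\}$. Then $\mathcal M$ is coherent on $\mathcal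 F$ if and only if (i) $S\neq\emptyset$, and (ii) if $I_0\ne\emptyset$, then the sub-assessment $(\mu_i,\ i\in I_0)$ on $\{X_i|K_i,\ i\in I_0\}$ is coherent (the recursion terminates because $I_0$ is a proper subset of $\{1,\dots,n\}$). *)

theory Defs
  imports Complex_Main
begin

text \<open>The set of elementary outcomes is the universe of the type \<open>'w\<close>; events are sets over it.\<close>

definition luk_tnorm :: "real \<Rightarrow> real \<Rightarrow> real" where
  "luk_tnorm u v = max (u + v - 1) 0"

text \<open>\<open>J\<close> is the set of positions at which the event itself, rather than its complement, is taken.\<close>

definition logically_independent :: "'w set list \<Rightarrow> bool" where
  "logically_independent Fs \<longleftrightarrow>
     (\<forall>J \<subseteq> {..<length Fs}.
        (\<Inter>i\<in>J. Fs ! i) \<inter> (\<Inter>i\<in>{..<length Fs} - J. - (Fs ! i)) \<noteq> {})"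

text \<open>
  The conjunction over \<open>S\<close> of the conditional events \<open>E i | H i\<close>, given previsions \<open>x\<close>. If neither
  of the first two cases applies, then \<open>S' = {i \<in> S. w \<notin> H i}\<close> is the only subset of \<open>S\<close> such that
  \<open>H i\<close> fails for all \<open>i \<in> S'\<close> and \<open>E i \<inter> H i\<close> holds for all \<open>i \<in> S - S'\<close>, and it is nonempty.
\<close>

definition conjunction ::
  "('k \<Rightarrow> 'w set) \<Rightarrow> ('k \<Rightarrow> 'w set) \<Rightarrow> ('k set \<Rightarrow> real) \<Rightarrow> 'k set \<Rightarrow> 'w \<Rightarrow> real" where
  "conjunction E H x S w =
     (if w \<in> (\<Inter>i\<in>S. E i \<inter> H i) then 1
      else if w \<in> (\<Union>i\<in>S. - E i \<inter> H i) then 0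
      else x {i \<in> S. w \<notin> H i})"

definition conditioning_event :: "('k \<Rightarrow> 'w set) \<Rightarrow> 'k set \<Rightarrow> 'w set" where
  "conditioning_event H S = (\<Union>i\<in>S. H i)"

definition partition_atoms :: "'w set set \<Rightarrow> 'w set set" where
  "partition_atoms G = {C. C \<noteq> {} \<and> (\<exists>P \<subseteq> G. C = \<Inter>P \<inter> (\<Inter>A\<in>G - P. - A))}"

text \<open>
  A family of conditional random quantities \<open>X i | K i\<close> is given by \<open>X\<close>, \<open>K\<close> and the set \<open>I\<close> of
  indices; only the values of \<open>X i\<close> on \<open>K i\<close> matter.
\<close>

definition generating_events ::
  "('i \<Rightarrow> 'w \<Rightarrow> real) \<Rightarrow> ('i \<Rightarrow> 'w set) \<Rightarrow> 'i set \<Rightarrow> 'w set set" where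
  "generating_events X K I =
     K ` I \<union> {{w \<in> K i. X i w = v} | i v. i \<in> I \<and> v \<in> X i ` K i}"

definition constituents ::
  "('i \<Rightarrow> 'w \<Rightarrow> real) \<Rightarrow> ('i \<Rightarrow> 'w set) \<Rightarrow> 'i set \<Rightarrow> 'w set set" where
  "constituents X K I =
     {C \<in> partition_atoms (generating_events X K I). C \<subseteq> (\<Union>i\<in>I. K i)}"

text \<open>If \<open>C\<close> is a constituent contained in \<open>K i\<close>, then \<open>X i\<close> is constant on \<open>C\<close>.\<close>

definition Q_point ::
  "('i \<Rightarrow> 'w \<Rightarrow> real) \<Rightarrow> ('i \<Rightarrow> 'w set) \<Rightarrow> ('i \<Rightarrow> real) \<Rightarrow> 'w set \<Rightarrow> 'i \<Rightarrow> real" where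
  "Q_point X K \<mu> C i = (if C \<subseteq> K i then the_elem (X i ` C) else \<mu> i)"

definition weight_solutions ::
  "('i \<Rightarrow> 'w \<Rightarrow> real) \<Rightarrow> ('i \<Rightarrow> 'w set) \<Rightarrow> ('i \<Rightarrow> real) \<Rightarrow> 'i set \<Rightarrow> ('w set \<Rightarrow> real) set" where
  "weight_solutions X K \<mu> I =
     {\<Lambda>. (\<forall>C \<in> constituents X K I. 0 \<le> \<Lambda> C) \<and>
         (\<Sum>C \<in> constituents X K I. \<Lambda> C) = 1 \<and>
         (\<forall>i\<in>I. (\<Sum>C \<in> constituents X K I. \<Lambda> C * Q_point X K \<mu> C i) = \<mu> i)}"

text \<open>
  Weights on the finitely many constituents that solve the system form a compact set, so when it is
  nonempty the supremum below is a maximum.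
\<close>

definition zero_indices ::
  "('i \<Rightarrow> 'w \<Rightarrow> real) \<Rightarrow> ('i \<Rightarrow> 'w set) \<Rightarrow> ('i \<Rightarrow> real) \<Rightarrow> 'i set \<Rightarrow> 'i set" where
  "zero_indices X K \<mu> I =
     {i \<in> I. (SUP \<Lambda> \<in> weight_solutions X K \<mu> I.
               \<Sum>C \<in> {C \<in> constituents X K I. C \<subseteq> K i}. \<Lambda> C) = 0}"

text \<open>
  The recursive characterization of coherence. Since \<open>zero_indices X K \<mu> I\<close> is a proper subset of the
  finite set \<open>I\<close> whenever the system is solvable, the recursion is well-founded and its least
  solution is the only one. The first three premises state that the family is an admissible one.
\<close>

inductive coherent ::
  "('i \<Rightarrow> 'w \<Rightarrow> real) \<Rightarrow> ('i \<Rightarrow> 'w set) \<Rightarrow> ('i \<Rightarrow> real) \<Rightarrow> 'i set \<Rightarrow> bool"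
  for X K \<mu> where
  "\<lbrakk> finite I;
     \<forall>i\<in>I. K i \<noteq> {};
     \<forall>i\<in>I. finite (X i ` K i);
     weight_solutions X K \<mu> I \<noteq> {};
     zero_indices X K \<mu> I \<noteq> {} \<longrightarrow> coherent X K \<mu> (zero_indices X K \<mu> I) \<rbrakk>
   \<Longrightarrow> coherent X K \<mu> I"

end

theory Submission
  imports Defs
begin

text \<open>
  If \<open>x\<^sub>1 + x\<^sub>2 + x\<^sub>3 > 2\<close>, every prevision in the assessment equals \<open>1 - (\<Sum>i\<in>S. 1 - x\<^sub>i)\<close>. Hence the
  assessment is the mixture of four points at which all \<open>H\<^sub>i\<close> are true: all \<open>E\<^sub>i\<close> true, with weight
  \<open>x\<^sub>1 + x\<^sub>2 + x\<^sub>3 - 2\<close>, or only \<open>E\<^sub>i\<close> false, with weight \<open>1 - x\<^sub>i\<close>. This solution gives every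
  conditioning event total weight \<open>1\<close>, so \<open>I\<^sub>0\<close> is empty.
\<close>

text \<open>This is the atom of the partition generated by \<open>G\<close> that contains
  \<open>w\<close>. Naming atoms by an outcome avoids tracking the subset \<open>P\<close> of
  \<open>G\<close> that \<open>partition_atoms\<close> quantifies over.\<close>

definition atom_at :: "'w set set \<Rightarrow> 'w \<Rightarrow> 'w set" where
  "atom_at G w = {v. \<forall>A\<in>G. v \<in> A \<longleftrightarrow> w \<in> A}"

lemma self_in_atom_at: "w \<in> atom_at G w"
  by (simp add: atom_at_def)

lemma atom_at_subset: "A \<in> G \<Longrightarrow> w \<in> A \<Longrightarrow> atom_at G w \<subseteq> A"
  by (auto simp: atom_at_def)

lemma atom_at_in_partition_atoms: "atom_at G w \<in> partition_atoms G"
proof -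
  let ?P = "{A\<in>G. w \<in> A}"
  have "atom_at G w = \<Inter>?P \<inter> (\<Inter>A\<in>G - ?P. - A)"
    by (auto simp: atom_at_def)
  moreover have "?P \<subseteq> G"
    by blast
  ultimately show ?thesis
    unfolding partition_atoms_def using self_in_atom_at[of w G] by blast
qed

lemma finite_partition_atoms:
  assumes "finite G"
  shows "finite (partition_atoms G)"
proof -
  have "partition_atoms G \<subseteq> (\<lambda>P. \<Inter>P \<inter> (\<Inter>A\<in>G - P. - A)) ` Pow G"
    by (auto simp: partition_atoms_def)
  then show ?thesis
    using assms by (meson finite_Pow_iff finite_imageI finite_subset)
qed

lemma finite_constituents:
  assumes "finite I" and "\<And>i. i \<in> I \<Longrightarrow> finite (X i ` K i)"
  shows "finite (constituents X K I)"
proof -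
  have "{{w \<in> K i. X i w = v} | i v. i \<in> I \<and> v \<in> X i ` K i}
      = (\<Union>i\<in>I. (\<lambda>v. {w \<in> K i. X i w = v}) ` (X i ` K i))"
    by auto
  then have "finite (generating_events X K I)"
    using assms by (simp add: generating_events_def)
  then show ?thesis
    unfolding constituents_def by (simp add: finite_partition_atoms)
qed

lemma atom_at_subset_conditioning:
  assumes "i \<in> I" and "w \<in> K i"
  shows "atom_at (generating_events X K I) w \<subseteq> K i"
  using assms by (intro atom_at_subset) (simp_all add: generating_events_def)

lemma atom_at_in_constituents:
  assumes "i \<in> I" and "w \<in> K i"
  shows "atom_at (generating_events X K I) w \<in> constituents X K I"
proof -
  have "atom_at (generating_events X K I) w \<subseteq> (\<Union>i\<in>I. K i)"
    using atom_at_subset_conditioning[of i I w K X, OF assms] UN_upper[OF assms(1)]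
    by (rule subset_trans)
  then show ?thesis
    unfolding constituents_def using atom_at_in_partition_atoms by (intro CollectI conjI)
qed

text \<open>The level set of \<open>X i\<close> through \<open>w\<close> is itself a generating
  event, so the atom of \<open>w\<close> lies inside it. Thus \<open>X i\<close> is constant on the
  atom and \<open>the_elem\<close> returns the value at \<open>w\<close>.\<close>

lemma Q_point_atom_at:
  assumes "i \<in> I" and "w \<in> K i"
  shows "Q_point X K \<mu> (atom_at (generating_events X K I) w) i = X i w"
proof -
  let ?C = "atom_at (generating_events X K I) w"
  have "{v \<in> K i. X i v = X i w} \<in> generating_events X K I"
    using assms by (auto simp: generating_events_def)
  then have "?C \<subseteq> {v \<in> K i. X i v = X i w}"
    using assms by (intro atom_at_subset) auto
  then have "X i ` ?C = {X i w}"
    using self_in_atom_at[of w] by blast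
  then show ?thesis
    using atom_at_subset_conditioning[of i I w K X, OF assms] by (simp add: Q_point_def)
qed

text \<open>Since every \<open>p j\<close> lies in every \<open>K i\<close>, the constituents that
  carry weight lie in all conditioning events, so the recursion in \<open>coherent\<close> stops at
  its first level.\<close>

lemma coherent_if_mixture:
  fixes p :: "'j \<Rightarrow> 'w" and a :: "'j \<Rightarrow> real"
  assumes fin: "finite I" "\<And>i. i \<in> I \<Longrightarrow> finite (X i ` K i)"
    and ne: "I \<noteq> {}"
    and a: "finite J" "\<And>j. j \<in> J \<Longrightarrow> 0 \<le> a j" "sum a J = 1"
    and p: "\<And>i j. i \<in> I \<Longrightarrow> j \<in> J \<Longrightarrow> p j \<in> K i"
    and mix: "\<And>i. i \<in> I \<Longrightarrow> (\<Sum>j\<in>J. a j * X i (p j)) = \<mu> i"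
  shows "coherent X K \<mu> I"
proof -
  let ?Cs = "constituents X K I"
  define c where "c j = atom_at (generating_events X K I) (p j)" for j
  \<comment> \<open>\<open>L\<close> is the push-forward of \<open>a\<close> along \<open>c\<close>;
    distinct indices may land in the same constituent, so their weights are added.\<close>
  define L where "L C = (\<Sum>j\<in>J. if c j = C then a j else 0)" for C
  have finC: "finite ?Cs"
    using fin by (rule finite_constituents)
  have c_in: "c j \<in> ?Cs" if "j \<in> J" for j
  proof -
    obtain i where "i \<in> I"
      using ne by blast
    then show ?thesis
      unfolding c_def using p that by (intro atom_at_in_constituents)
  qed
  \<comment> \<open>Change of variables for the push-forward. \<open>D\<close> is left general
    because it is used both for all constituents and for those inside one
    \<open>K i\<close>.\<close>
  have sum_L: "(\<Sum>C\<in>D. L C * f C) = (\<Sum>j\<in>J. a j * f (c j))"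
    if "finite D" "\<And>j. j \<in> J \<Longrightarrow> c j \<in> D" for D f
  proof -
    have "(\<Sum>C\<in>D. L C * f C) = (\<Sum>C\<in>D. \<Sum>j\<in>J. if c j = C then a j * f C else 0)"
      by (auto simp: L_def sum_distrib_right intro!: sum.cong)
    also have "\<dots> = (\<Sum>j\<in>J. \<Sum>C\<in>D. if c j = C then a j * f C else 0)"
      by (rule sum.swap)
    also have "\<dots> = (\<Sum>j\<in>J. a j * f (c j))"
      using that by (intro sum.cong) (simp_all add: sum.delta')
    finally show ?thesis .
  qed
  have L_mem: "L \<in> weight_solutions X K \<mu> I"
  proof -
    have "0 \<le> L C" for C
      using a(2) by (auto simp: L_def intro!: sum_nonneg)
    moreover have "sum L ?Cs = 1"
      using sum_L[OF finC c_in, of "\<lambda>_. 1"] a(3) by simp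
    moreover have "(\<Sum>C\<in>?Cs. L C * Q_point X K \<mu> C i) = \<mu> i" if "i \<in> I" for i
      using sum_L[OF finC c_in, of "\<lambda>C. Q_point X K \<mu> C i"] mix[OF that] p that
      by (simp add: c_def Q_point_atom_at)
    ultimately show ?thesis
      by (simp add: weight_solutions_def)
  qed
  have "i \<notin> zero_indices X K \<mu> I" if i: "i \<in> I" for i
  proof -
    let ?D = "{C \<in> ?Cs. C \<subseteq> K i}"
    have "c j \<in> ?D" if "j \<in> J" for j
      using c_in[OF that] i p[OF i that] by (simp add: c_def atom_at_subset_conditioning)
    then have "sum L ?D = 1"
      using sum_L[of ?D "\<lambda>_. 1"] finC a(3) by simp
    \<comment> \<open>On the reals, an element bounds the supremum from below only if the set is
      bounded above; here the total weight 1 is the bound.\<close>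
    moreover have "bdd_above ((\<lambda>M. sum M ?D) ` weight_solutions X K \<mu> I)"
    proof (rule bdd_aboveI2)
      fix M assume "M \<in> weight_solutions X K \<mu> I"
      then have "\<forall>C\<in>?Cs. 0 \<le> M C" "sum M ?Cs = 1"
        by (auto simp: weight_solutions_def)
      then show "sum M ?D \<le> 1"
        using sum_mono2[OF finC, of ?D M] by auto
    qed
    ultimately have "1 \<le> (SUP M \<in> weight_solutions X K \<mu> I. sum M ?D)"
      using cSUP_upper[OF L_mem, of "\<lambda>M. sum M ?D"] by simp
    then show ?thesis
      by (simp add: zero_indices_def)
  qed
  then have "zero_indices X K \<mu> I = {}"
    by (auto simp: zero_indices_def)
  moreover have "J \<noteq> {}"
    using a(3) by auto
  then have "\<forall>i\<in>I. K i \<noteq> {}"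
    using p by blast
  ultimately show ?thesis
    using fin L_mem by (intro coherent.intros) auto
qed

lemma finite_conjunction_values:
  assumes "finite S"
  shows "finite (conjunction E H x S ` A)"
proof (rule finite_subset)
  show "conjunction E H x S ` A \<subseteq> {0, 1} \<union> x ` Pow S"
    by (auto simp: conjunction_def)
qed (use assms in simp)

lemma conjunction_all_conditions_true:
  assumes "\<And>i. i \<in> S \<Longrightarrow> w \<in> H i"
  shows "conjunction E H x S w = (if \<forall>i\<in>S. w \<in> E i then 1 else 0)"
  using assms by (auto simp: conjunction_def)

lemma logically_independentE:
  assumes "logically_independent Fs" and "J \<subseteq> {..<length Fs}"
  obtains w where "\<And>k. k < length Fs \<Longrightarrow> w \<in> Fs ! k \<longleftrightarrow> k \<in> J"
proof -
  have "(\<Inter>i\<in>J. Fs ! i) \<inter> (\<Inter>i\<in>{..<length Fs} - J. - (Fs ! i)) \<noteq> {}"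
    using assms by (simp add: logically_independent_def)
  then obtain w where "w \<in> (\<Inter>i\<in>J. Fs ! i)" "w \<in> (\<Inter>i\<in>{..<length Fs} - J. - (Fs ! i))"
    by auto
  then show ?thesis
    using that[of w] by auto
qed

lemma ex_outcome:
  fixes E H :: "nat \<Rightarrow> 'w set"
  assumes "logically_independent [E 1, E 2, E 3, H 1, H 2, H 3]"
  shows "\<exists>w. \<forall>i\<in>{1, 2, 3}. w \<in> H i \<and> (w \<in> E i \<longleftrightarrow> i \<in> A)"
proof -
  let ?Fs = "[E 1, E 2, E 3, H 1, H 2, H 3]"
  \<comment> \<open>Positions count from 0: \<open>E i\<close> stands at position
    \<open>i - 1\<close>, and the three \<open>H i\<close> fill positions 3, 4, 5.\<close>
  let ?J = "{k. k < 3 \<and> Suc k \<in> A} \<union> {3, 4, 5}"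
  have "?J \<subseteq> {..<length ?Fs}"
    by auto
  with assms obtain w where w: "\<And>k. k < length ?Fs \<Longrightarrow> w \<in> ?Fs ! k \<longleftrightarrow> k \<in> ?J"
    by (rule logically_independentE) blast
  have "w \<in> E 1 \<longleftrightarrow> 1 \<in> A" "w \<in> E 2 \<longleftrightarrow> 2 \<in> A" "w \<in> E 3 \<longleftrightarrow> 3 \<in> A"
    using w[of 0] w[of 1] w[of 2] by (simp_all add: numeral_2_eq_2 numeral_3_eq_3)
  moreover have "w \<in> H 1" "w \<in> H 2" "w \<in> H 3"
    using w[of 3] w[of 4] w[of 5] by simp_all
  ultimately show ?thesis
    by (intro exI[of _ w]) simp
qed

lemma nonempty_subset_of_three:
  assumes "A \<noteq> {}" and "A \<subseteq> {a, b, c}"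
  shows "A \<in> {{a}, {b}, {c}, {a, b}, {a, c}, {b, c}, {a, b, c}}"
proof -
  have "A \<in> Pow {a, b, c}"
    using assms(2) by blast
  then show ?thesis
    using assms(1) unfolding Pow_insert Pow_empty
    by (elim UnE imageE insertE emptyE) simp_all
qed

theorem theorem11:
  fixes E H :: "nat \<Rightarrow> 'w set"
    and x1 x2 x3 :: real
    and x :: "nat set \<Rightarrow> real"
  assumes "logically_independent [E 1, E 2, E 3, H 1, H 2, H 3]"
    and "x1 \<in> {0..1}" and "x2 \<in> {0..1}" and "x3 \<in> {0..1}"
    and "x {1} = x1" and "x {2} = x2" and "x {3} = x3"
    and "x {1, 2} = luk_tnorm x1 x2"
    and "x {1, 3} = luk_tnorm x1 x3"
    and "x {2, 3} = luk_tnorm x2 x3"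
    and "x {1, 2, 3} = luk_tnorm (luk_tnorm x1 x2) x3"
    and "luk_tnorm (luk_tnorm x1 x2) x3 > 0"
  shows "coherent (conjunction E H x) (conditioning_event H) x (Pow {1, 2, 3} - {{}})"
proof -
  \<comment> \<open>If the inner maximum were 0, the outer one would be
    \<open>max (x3 - 1) 0\<close>, which is 0 because \<open>x3\<close> is at most 1. So both maxima
    are attained by their affine parts.\<close>
  have s: "x1 + x2 + x3 > 2"
    using assms(2-4,12) by (auto simp: luk_tnorm_def max_def split: if_splits)
  \<comment> \<open>As each \<open>x\<^sub>i\<close> is at most 1, a total above 2 makes every pair
    sum exceed 1.\<close>
  have pair: "x {1, 2} = x1 + x2 - 1" "x {1, 3} = x1 + x3 - 1" "x {2, 3} = x2 + x3 - 1"
    and triple: "x {1, 2, 3} = x1 + x2 + x3 - 2"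
    using s assms(2-4,8-11) by (auto simp: luk_tnorm_def)
  let ?I = "Pow {1, 2, 3} - {{}} :: nat set set"
  \<comment> \<open>The index 0 differs from all of 1, 2, 3, so \<open>j = 0\<close> yields the
    outcome where every \<open>E i\<close> is true, and one formula covers all four points.\<close>
  have "\<exists>w. \<forall>i\<in>{1, 2, 3}. w \<in> H i \<and> (w \<in> E i \<longleftrightarrow> i \<noteq> j)" for j
    using ex_outcome[OF assms(1), of "- {j}"] by simp
  then obtain p where p: "\<And>j i. i \<in> {1, 2, 3} \<Longrightarrow> p j \<in> H i \<and> (p j \<in> E i \<longleftrightarrow> i \<noteq> j)"
    by metis
  define a :: "nat \<Rightarrow> real"
    where "a j = (if j = 0 then x1 + x2 + x3 - 2 else 1 - x {j})" for j
  \<comment> \<open>No \<open>H i\<close> fails at \<open>p j\<close>, so no prevision enters as a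
    value: the conjunction is an indicator, false exactly when the one false event
    \<open>E j\<close> is among its members.\<close>
  have val: "conjunction E H x S (p j) = (if j \<in> S then 0 else 1)" if "S \<in> ?I" for S j
  proof -
    have "p j \<in> H i" "p j \<in> E i \<longleftrightarrow> i \<noteq> j" if "i \<in> S" for i
      using p[of i j] that \<open>S \<in> ?I\<close> by blast+
    then show ?thesis
      by (auto simp: conjunction_all_conditions_true)
  qed
  show ?thesis
  proof (rule coherent_if_mixture[where J = "{0, 1, 2, 3}" and a = a and p = p])
    show "finite (conjunction E H x S ` conditioning_event H S)" if "S \<in> ?I" for S
      using that by (intro finite_conjunction_values) (auto intro: finite_subset)
    show "0 \<le> a j" if "j \<in> {0, 1, 2, 3}" for j
      using that s assms(2-7) by (auto simp: a_def)
    show "sum a {0, 1, 2, 3} = 1"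
      using assms(5-7) by (simp add: a_def)
    show "p j \<in> conditioning_event H S" if "S \<in> ?I" for S j
    proof -
      obtain i where "i \<in> S" "i \<in> {1, 2, 3}"
        using \<open>S \<in> ?I\<close> by blast
      then show ?thesis
        using p[of i j] unfolding conditioning_event_def by blast
    qed
    show "(\<Sum>j\<in>{0, 1, 2, 3}. a j * conjunction E H x S (p j)) = x S" if S: "S \<in> ?I" for S
    proof -
      have "S \<in> {{1}, {2}, {3}, {1, 2}, {1, 3}, {2, 3}, {1, 2, 3}}"
        using S by (intro nonempty_subset_of_three) auto
      \<comment> \<open>What remains is the total weight of the indices outside \<open>S\<close>,
        that is, 1 minus the weights \<open>1 - x {j}\<close> with \<open>j\<close> in
        \<open>S\<close>.\<close>
      then show ?thesis
        unfolding val[OF S] using assms(5-7) pair triple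
        by (elim insertE emptyE) (simp_all add: a_def)
    qed
    show "?I \<noteq> {}"
      by blast
  qed simp_all
qed

end
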